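(* Let $X$ be a separable Banach space such that $X^*$ fails the $(-1)$-BCP. Then there exists an equivalent norm $|||\cdot|||$ on $X$, with dual norm $|||\cdot|||^*$ on $X^*$, such that $(X^*,|||\cdot|||^* )$ has the ball-covering property (BCP), but $$\operatorname{bc}\bigl((X^*,|||\cdot|||^* )\bigr)<1.$$ In particular, the closed unit ball $B_{(X,|||\cdot|||)}$ is not a slicely countably determined (SCD) set.
   Context: All Banach spaces are real. $S_Z$ is the unit sphere of a Banach space $Z$ and $B(z,r)$ the open ball with center $z$ and radius $r>0$. For $\alpha\in[-1,1)$, $Z$ has the $\alpha$-BCP if there is a countable collection of open balls $\{B(z_n,r_n)\}$, $r_n>0$, with $S_Z\subset\bigcup_n B(z_n,r_n)$ and $\|z_n\|\ge r_n+\alpha$ for all $n$. The BCP is the $0$-BCP. The ball-covering index is $\operatorname{bc}(Z):=\sup\{\alpha\in[-1,1): Z\text{ has the }\alpha\text{-BCP}\}$ ($=-1$ if this set is empty). A slice of a bounded convex set $A$ is a non-empty intersection of $A$ with an open half-space. A bounded convex set $A$ is an SCD set if there is a sequence $(S_n)_{n\in\mathbb N}$ of slices of $A$ such that $A\subseteq\overline{\operatorname{conv}}\{b_n:n\in\mathbb N\}$ for every sequence $(b_n)$ with $b_n\in S_n$ for all $n$. *)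

theory Defs
  imports "HOL-Analysis.Analysis"
begin

(* Several norms on the same vector space are compared, so a norm is an explicit function;
   the norm of the type class fixes the ambient topology. *)

definition is_norm :: "('a::real_vector \<Rightarrow> real) \<Rightarrow> bool" where
  "is_norm N \<longleftrightarrow>
     (\<forall>x. N x \<ge> 0) \<and> (\<forall>x. N x = 0 \<longleftrightarrow> x = 0) \<and>
     (\<forall>a x. N (a *\<^sub>R x) = \<bar>a\<bar> * N x) \<and> (\<forall>x y. N (x + y) \<le> N x + N y)"

definition equivalent_norm :: "('a::real_normed_vector \<Rightarrow> real) \<Rightarrow> bool" where
  "equivalent_norm N \<longleftrightarrow>
     is_norm N \<and> (\<exists>c>0. \<exists>C>0. \<forall>x. c * norm x \<le> N x \<and> N x \<le> C * norm x)"

definition sphere_of :: "('a::real_vector \<Rightarrow> real) \<Rightarrow> 'a set" where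
  "sphere_of N = {x. N x = 1}"

definition ball_of :: "('a::real_vector \<Rightarrow> real) \<Rightarrow> 'a \<Rightarrow> real \<Rightarrow> 'a set" where
  "ball_of N z r = {x. N (x - z) < r}"

definition unit_cball_of :: "('a::real_vector \<Rightarrow> real) \<Rightarrow> 'a set" where
  "unit_cball_of N = {x. N x \<le> 1}"

(* For an equivalent norm N, the N-continuous functionals are exactly the elements of
   the type of bounded linear functionals, so this is a norm on the whole dual. *)
definition dual_norm ::
  "('a::real_normed_vector \<Rightarrow> real) \<Rightarrow> ('a \<Rightarrow>\<^sub>L real) \<Rightarrow> real" where
  "dual_norm N f = (SUP x\<in>unit_cball_of N. \<bar>blinfun_apply f x\<bar>)"

(* A countable collection of balls is given by its countable set of (centre, radius) pairs. *)
definition has_BCP :: "('z::real_vector \<Rightarrow> real) \<Rightarrow> real \<Rightarrow> bool" where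
  "has_BCP N \<alpha> \<longleftrightarrow>
     (\<exists>B :: ('z \<times> real) set. countable B \<and>
        (\<forall>(z, r)\<in>B. r > 0 \<and> N z \<ge> r + \<alpha>) \<and>
        sphere_of N \<subseteq> (\<Union>(z, r)\<in>B. ball_of N z r))"

definition bc :: "('z::real_vector \<Rightarrow> real) \<Rightarrow> real" where
  "bc N = (let A = {\<alpha>\<in>{-1..<1}. has_BCP N \<alpha>} in if A = {} then -1 else Sup A)"

definition is_slice :: "'a::real_normed_vector set \<Rightarrow> 'a set \<Rightarrow> bool" where
  "is_slice A S \<longleftrightarrow>
     S \<noteq> {} \<and>
     (\<exists>(f :: 'a \<Rightarrow>\<^sub>L real) a. f \<noteq> 0 \<and> S = A \<inter> {x. blinfun_apply f x > a})"

definition SCD_set :: "'a::real_normed_vector set \<Rightarrow> bool" where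
  "SCD_set A \<longleftrightarrow>
     bounded A \<and> convex A \<and>
     (\<exists>S :: nat \<Rightarrow> 'a set. (\<forall>n. is_slice A (S n)) \<and>
        (\<forall>b. (\<forall>n. b n \<in> S n) \<longrightarrow> A \<subseteq> closure (convex hull (range b))))"

lemma dual_norm_norm: "dual_norm norm f = norm f"
proof (rule antisym)
  have bound: "\<bar>blinfun_apply f x\<bar> \<le> norm f" if "norm x \<le> 1" for x
    using norm_blinfun[of f x] mult_left_mono[OF that norm_ge_zero[of f]] by simp
  have bdd: "bdd_above ((\<lambda>x. \<bar>blinfun_apply f x\<bar>) ` unit_cball_of norm)"
    using bound by (auto simp: unit_cball_of_def intro!: bdd_aboveI)
  have z: "0 \<in> unit_cball_of (norm :: 'a \<Rightarrow> real)" by (simp add: unit_cball_of_def)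
  show "dual_norm norm f \<le> norm f"
    unfolding dual_norm_def
    using z bound by (intro cSUP_least) (blast, simp add: unit_cball_of_def)
  have "0 \<le> dual_norm norm f"
    unfolding dual_norm_def using cSUP_upper[OF z bdd] by simp
  then show "norm f \<le> dual_norm norm f"
  proof (rule norm_blinfun_bound)
    fix x
    show "norm (blinfun_apply f x) \<le> dual_norm norm f * norm x"
    proof (cases "x = 0")
      case False
      have "x /\<^sub>R norm x \<in> unit_cball_of norm"
        using False by (simp add: unit_cball_of_def)
      from cSUP_upper[OF this bdd]
      have "\<bar>blinfun_apply f (x /\<^sub>R norm x)\<bar> \<le> dual_norm norm f"
        unfolding dual_norm_def .
      then show ?thesis
        using False by (simp add: blinfun.scaleR_right abs_mult field_simps)
    qed simp
  qed
qed

(* The side conditions in SCD_set hold for the unit ball of every equivalent norm,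
   so its failure to be SCD is never due to them. *)
lemma equivalent_norm_unit_cball:
  assumes "equivalent_norm N"
  shows "bounded (unit_cball_of N)" "convex (unit_cball_of N)"
proof -
  obtain c where c: "c > 0" "\<And>x. c * norm x \<le> N x"
    using assms by (auto simp: equivalent_norm_def)
  have "norm x \<le> 1 / c" if "N x \<le> 1" for x
    using c(2)[of x] that c(1) by (simp add: field_simps)
  then show "bounded (unit_cball_of N)"
    by (auto simp: bounded_iff unit_cball_of_def)
  have N: "N (a *\<^sub>R x) = \<bar>a\<bar> * N x" "N (x + y) \<le> N x + N y" for a x y
    using assms by (auto simp: equivalent_norm_def is_norm_def)
  show "convex (unit_cball_of N)"
  proof (rule convexI)
    fix x y :: 'a and u v :: real
    assume "x \<in> unit_cball_of N" "y \<in> unit_cball_of N" and uv: "0 \<le> u" "0 \<le> v" "u + v = 1"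
    then have "u * N x \<le> u" "v * N y \<le> v"
      by (auto simp: unit_cball_of_def mult_left_le)
    then show "u *\<^sub>R x + v *\<^sub>R y \<in> unit_cball_of N"
      using N(2)[of "u *\<^sub>R x" "v *\<^sub>R y"] uv by (simp add: N(1) unit_cball_of_def)
  qed
qed

end

theory Submission
  imports Defs
begin

text \<open>
  Choose a total summable sequence \<open>w\<close> in \<open>X\<close> and put \<open>T f = \<Sum> f(w\<^sub>n) w\<^sub>n\<close>,
  \<open>q(f)\<^sup>2 = f(T f)\<close>. The inf-convolution of the norm with \<open>T z \<mapsto> q z\<close> is an equivalent norm
  on \<open>X\<close> with dual norm \<open>p f = max \<parallel>f\<parallel> (q f)\<close>. On the open cone \<open>\<parallel>z\<parallel> < q z\<close> the norm \<open>p\<close> is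
  smooth with derivative proportional to \<open>T z \<in> X\<close>; as \<open>X\<close> is separable, countably many such \<open>z\<close>
  have a total set of derivatives, and the balls \<open>B(\<plusminus>k z, k p(z))\<close> cover the sphere.

  Conversely, failure of the \<open>(-1)\<close>-BCP gives, for any countable \<open>D\<close>, some \<open>x\<close> of norm one with
  \<open>\<parallel>f - x\<parallel> = \<parallel>f\<parallel> + 1\<close> on \<open>D\<close>. Averaging two of these with a sign makes \<open>\<bar>x(u)\<bar> \<le> 1/2\<close> for a
  prescribed unit vector \<open>u\<close>. With \<open>w\<^sub>0 = \<surd>2 u\<close> and a small remainder this yields
  \<open>q x \<le> \<alpha> < 1\<close>, hence \<open>p(f - x) \<ge> p f - \<alpha>\<close> on \<open>D\<close>, which rules out the \<open>\<beta>\<close>-BCP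
  for \<open>\<beta> > \<alpha>\<close> and the SCD property.
\<close>

section \<open>Directions far from a countable set of functionals\<close>

text \<open>The countably many balls with centre \<open>z\<close> in \<open>D\<close> and radius
  \<open>norm z + 1\<close> are admissible for the (-1)-BCP. They cannot cover the sphere, and any
  point they miss serves as \<open>x\<close>.\<close>

lemma not_BCP_minus_one_direction:
  fixes D :: "'z::real_normed_vector set"
  assumes "\<not> has_BCP (norm :: 'z \<Rightarrow> real) (-1)" and "countable D"
  shows "\<exists>x. norm x = 1 \<and> (\<forall>z\<in>D. norm z + 1 \<le> norm (z - x))"
proof (rule ccontr)
  assume *: "\<not> ?thesis"
  have "has_BCP (norm :: 'z \<Rightarrow> real) (-1)"
    unfolding has_BCP_def
  proof (intro exI conjI)
    show "countable ((\<lambda>z. (z, norm z + 1)) ` D)"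
      using assms(2) by simp
    show "\<forall>(z, r)\<in>(\<lambda>z. (z, norm z + 1)) ` D. 0 < r \<and> r + - 1 \<le> norm z"
      by (auto simp: add_nonneg_pos)
    show "sphere_of norm \<subseteq> (\<Union>(z, r)\<in>(\<lambda>z. (z, norm z + 1)) ` D. ball_of norm z r)"
      using * by (fastforce simp: sphere_of_def ball_of_def norm_minus_commute not_le)
  qed
  with assms(1) show False by contradiction
qed

text \<open>Far directions survive averaging: if \<open>x1\<close> is far from every
  \<open>2f\<close>, and \<open>x2\<close> is far from every \<open>2f - x1\<close> and from its
  negative, then both \<open>(x1 + x2)/2\<close> and \<open>(x1 - x2)/2\<close> are far from
  \<open>D\<close>. One of the two is small at \<open>u\<close>.\<close>

lemma not_BCP_minus_one_direction_small:
  fixes D :: "('a::real_normed_vector \<Rightarrow>\<^sub>L real) set"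
  assumes nB: "\<not> has_BCP (norm :: ('a \<Rightarrow>\<^sub>L real) \<Rightarrow> real) (-1)"
    and D: "countable D" and u: "norm u \<le> 1"
  shows "\<exists>x. norm x = 1 \<and> \<bar>blinfun_apply x u\<bar> \<le> 1/2 \<and> (\<forall>f\<in>D. norm f + 1 \<le> norm (f - x))"
proof -
  \<comment> \<open>Being far from 0 will give \<open>1 \<le> norm x\<close>.\<close>
  define D0 where "D0 = insert 0 D"
  have "countable ((\<lambda>f. 2 *\<^sub>R f) ` D0)"
    using D by (simp add: D0_def)
  from not_BCP_minus_one_direction[OF nB this]
  obtain x1 where x1: "norm x1 = 1" "\<And>f. f \<in> D0 \<Longrightarrow> 2 * norm f + 1 \<le> norm (2 *\<^sub>R f - x1)"
    by auto
  \<comment> \<open>The sign \<open>s\<close> is known only after \<open>x2\<close>, so both signs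
    of \<open>2f - x1\<close> enter the set from which \<open>x2\<close> is chosen far.\<close>
  have "countable ((\<lambda>f. 2 *\<^sub>R f - x1) ` D0 \<union> (\<lambda>f. - (2 *\<^sub>R f - x1)) ` D0)"
    using D by (simp add: D0_def)
  from not_BCP_minus_one_direction[OF nB this]
  obtain x2 where x2: "norm x2 = 1"
    "\<And>f. f \<in> D0 \<Longrightarrow> norm (2 *\<^sub>R f - x1) + 1 \<le> norm (2 *\<^sub>R f - x1 - x2)"
    "\<And>f. f \<in> D0 \<Longrightarrow> norm (- (2 *\<^sub>R f - x1)) + 1 \<le> norm (- (2 *\<^sub>R f - x1) - x2)"
    by blast
  have "\<bar>blinfun_apply x1 u\<bar> \<le> 1" "\<bar>blinfun_apply x2 u\<bar> \<le> 1"
    using norm_blinfun[of x1 u] norm_blinfun[of x2 u] u x1(1) x2(1) by auto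
  \<comment> \<open>The smaller of |a + b| and |a - b| is ||a| - |b||, which is at most 1 when |a|
    and |b| are.\<close>
  then obtain s :: real where s: "s = 1 \<or> s = -1"
    and su: "\<bar>blinfun_apply x1 u + s * blinfun_apply x2 u\<bar> \<le> 1"
    using that[of 1] that[of "-1"] by linarith
  define x where "x = (1/2) *\<^sub>R (x1 + s *\<^sub>R x2)"
  have far: "norm f + 1 \<le> norm (f - x)" if "f \<in> D0" for f
  proof -
    have "2 * norm f + 2 \<le> norm (2 *\<^sub>R f - x1 - s *\<^sub>R x2)"
      using s
    proof
      assume "s = 1"
      then show ?thesis using x1(2)[OF that] x2(2)[OF that] by simp
    next
      assume "s = -1"
      moreover have "norm (2 *\<^sub>R f - x1 + x2) = norm (- (2 *\<^sub>R f - x1) - x2)"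
        by (subst norm_minus_cancel[symmetric]) simp
      moreover have "norm (- (2 *\<^sub>R f - x1)) = norm (2 *\<^sub>R f - x1)"
        by (rule norm_minus_cancel)
      ultimately show ?thesis using x1(2)[OF that] x2(3)[OF that] by simp
    qed
    also have "2 *\<^sub>R f - x1 - s *\<^sub>R x2 = 2 *\<^sub>R (f - x)"
      by (simp add: x_def algebra_simps)
    finally show ?thesis by simp
  qed
  have "norm (x1 + s *\<^sub>R x2) \<le> 2"
    using norm_triangle_ineq[of x1 "s *\<^sub>R x2"] s x1(1) x2(1) by auto
  then have "norm x \<le> 1" by (simp add: x_def)
  moreover have "1 \<le> norm x" using far[of 0] by (simp add: D0_def)
  moreover have "\<bar>blinfun_apply x u\<bar> \<le> 1/2"
    using su by (simp add: x_def blinfun.scaleR_left blinfun.add_left abs_mult)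
  ultimately show ?thesis
    using far by (intro exI[of _ x]) (auto simp: D0_def)
qed

section \<open>Renorming by a positive definite symmetric form on the dual\<close>

text \<open>The bound on \<open>norm (T f)\<close> makes \<open>T\<close> continuous from the
  Hilbertian norm \<open>q\<close> below into the space; it is what keeps the new norm bounded below
  by a multiple of \<open>norm\<close>.\<close>

locale dual_form =
  fixes T :: "('a::real_normed_vector \<Rightarrow>\<^sub>L real) \<Rightarrow> 'a" and C :: real
  assumes T_linear: "linear T"
    and sym: "blinfun_apply f (T g) = blinfun_apply g (T f)"
    and pos: "f \<noteq> 0 \<Longrightarrow> 0 < blinfun_apply f (T f)"
    and norm_T_le: "norm (T f) \<le> C * sqrt (blinfun_apply f (T f))"
begin

definition q :: "('a \<Rightarrow>\<^sub>L real) \<Rightarrow> real" where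
  "q f = sqrt (blinfun_apply f (T f))"

definition pnorm :: "('a \<Rightarrow>\<^sub>L real) \<Rightarrow> real" where
  "pnorm f = max (norm f) (q f)"

text \<open>Its closed unit ball is the closed convex hull of the \<open>norm\<close> unit ball and
  the \<open>T\<close>-image of the \<open>q\<close> unit ball, which is why the dual norm is a
  maximum of two.\<close>

definition renorm :: "'a \<Rightarrow> real" where
  "renorm x = (INF z. norm (x - T z) + q z)"

lemmas T_simps = linear_add[OF T_linear] linear_diff[OF T_linear] linear_scale[OF T_linear]
  linear_0[OF T_linear]

lemma form_nonneg: "0 \<le> blinfun_apply f (T f)"
  using pos[of f] by (cases "f = 0") auto

lemma q_nonneg [simp]: "0 \<le> q f"
  by (simp add: q_def form_nonneg)

lemma q_sq: "(q f)\<^sup>2 = blinfun_apply f (T f)"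
  by (simp add: q_def form_nonneg)

lemma q_0 [simp]: "q 0 = 0"
  by (simp add: q_def)

lemma q_scaleR: "q (a *\<^sub>R f) = \<bar>a\<bar> * q f"
  by (simp add: q_def T_simps blinfun.scaleR_left blinfun.scaleR_right
      real_sqrt_mult flip: mult.assoc)

lemma q_minus: "q (- f) = q f"
  using q_scaleR[of "-1" f] by simp

lemma q_sq_diff: "(q (f - t *\<^sub>R g))\<^sup>2 = (q f)\<^sup>2 - 2 * t * blinfun_apply f (T g) + t\<^sup>2 * (q g)\<^sup>2"
  unfolding q_sq
  by (simp add: T_simps blinfun.bilinear_simps sym[of g f]) (simp add: power2_eq_square algebra_simps)

lemma form_le: "\<bar>blinfun_apply f (T g)\<bar> \<le> q f * q g"
proof (cases "g = 0")
  case False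
  then have g: "0 < (q g)\<^sup>2" using pos q_sq by simp
  \<comment> \<open>Cauchy-Schwarz: this \<open>t\<close> minimises
    \<open>q (f - t *\<^sub>R g)\<close>.\<close>
  define t where "t = blinfun_apply f (T g) / (q g)\<^sup>2"
  have "0 \<le> (q f)\<^sup>2 - 2 * t * blinfun_apply f (T g) + t\<^sup>2 * (q g)\<^sup>2"
    by (subst q_sq_diff[symmetric]) simp
  also have "\<dots> = (q f)\<^sup>2 - (blinfun_apply f (T g))\<^sup>2 / (q g)\<^sup>2"
    using g by (simp add: t_def power2_eq_square field_simps)
  finally have "(blinfun_apply f (T g))\<^sup>2 \<le> (q f * q g)\<^sup>2"
    using g by (simp add: field_simps)
  then show ?thesis
    by (simp add: abs_le_square_iff[symmetric])
qed (simp add: T_simps)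

lemma q_triangle: "q (f + g) \<le> q f + q g"
proof (rule power2_le_imp_le)
  have "(q (f + g))\<^sup>2 = (q f)\<^sup>2 + 2 * blinfun_apply f (T g) + (q g)\<^sup>2"
    using q_sq_diff[of f "-1" g] by simp
  also have "\<dots> \<le> (q f)\<^sup>2 + 2 * (q f * q g) + (q g)\<^sup>2"
    using form_le[of f g] by linarith
  finally show "(q (f + g))\<^sup>2 \<le> (q f + q g)\<^sup>2"
    by (simp add: power2_sum)
qed simp

lemma q_diff_ge: "q f - q g \<le> q (f - g)"
  using q_triangle[of "f - g" g] by simp

lemma pnorm_scaleR: "pnorm (a *\<^sub>R f) = \<bar>a\<bar> * pnorm f"
  by (simp add: pnorm_def q_scaleR max_mult_distrib_left)

lemma pnorm_minus: "pnorm (- f) = pnorm f"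
  using pnorm_scaleR[of "-1" f] by simp

lemma renorm_bdd: "bdd_below (range (\<lambda>z. norm (x - T z) + q z))"
  by (rule bdd_belowI[of _ 0]) auto

lemma renorm_le: "renorm x \<le> norm (x - T z) + q z"
  unfolding renorm_def by (rule cINF_lower[OF renorm_bdd]) simp

lemma renorm_approx:
  assumes "0 < e" obtains z where "norm (x - T z) + q z < renorm x + e"
proof -
  have "(INF z. norm (x - T z) + q z) < renorm x + e"
    using assms by (simp add: renorm_def)
  then obtain z where "norm (x - T z) + q z < renorm x + e"
    using cINF_less_iff[OF UNIV_not_empty renorm_bdd[of x]] by blast
  then show thesis by (rule that)
qed

lemma renorm_le_norm: "renorm x \<le> norm x"
  using renorm_le[of x 0] by (simp add: T_simps)

lemma renorm_T_le: "renorm (T f) \<le> q f"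
  using renorm_le[of "T f" f] by simp

lemma norm_le_renorm: "norm x \<le> max 1 C * renorm x"
proof -
  have m: "0 < max 1 C" by simp
  have "norm x / max 1 C \<le> renorm x"
    unfolding renorm_def
  proof (rule cINF_greatest)
    fix z
    have "norm x \<le> norm (x - T z) + norm (T z)"
      using norm_triangle_ineq[of "x - T z" "T z"] by simp
    also have "\<dots> \<le> 1 * norm (x - T z) + C * q z"
      using norm_T_le[of z] by (simp add: q_def)
    also have "\<dots> \<le> max 1 C * norm (x - T z) + max 1 C * q z"
      by (intro add_mono mult_right_mono) auto
    finally have "norm x \<le> max 1 C * (norm (x - T z) + q z)"
      by (simp add: algebra_simps)
    then show "norm x / max 1 C \<le> norm (x - T z) + q z"
      using m by (simp add: divide_le_eq mult.commute)
  qed simp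
  then show ?thesis using m by (simp add: divide_le_eq mult.commute)
qed

lemma renorm_nonneg: "0 \<le> renorm x"
  unfolding renorm_def by (rule cINF_greatest) auto

lemma renorm_scaleR_le: "renorm (a *\<^sub>R x) \<le> \<bar>a\<bar> * renorm x"
proof (cases "a = 0")
  case True
  then show ?thesis using renorm_le_norm[of 0] by simp
next
  case False
  show ?thesis
  proof (rule field_le_epsilon)
    fix e :: real assume "0 < e"
    then have "0 < e / \<bar>a\<bar>" using False by simp
    then obtain z where z: "norm (x - T z) + q z < renorm x + e / \<bar>a\<bar>"
      by (rule renorm_approx)
    have "renorm (a *\<^sub>R x) \<le> norm (a *\<^sub>R (x - T z)) + q (a *\<^sub>R z)"
      using renorm_le[of "a *\<^sub>R x" "a *\<^sub>R z"] by (simp add: T_simps scaleR_diff_right)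
    also have "\<dots> = \<bar>a\<bar> * (norm (x - T z) + q z)"
      by (simp add: q_scaleR distrib_left)
    also have "\<dots> \<le> \<bar>a\<bar> * (renorm x + e / \<bar>a\<bar>)"
      using z by (intro mult_left_mono) auto
    finally show "renorm (a *\<^sub>R x) \<le> \<bar>a\<bar> * renorm x + e"
      using False by (simp add: algebra_simps)
  qed
qed

lemma renorm_scaleR: "renorm (a *\<^sub>R x) = \<bar>a\<bar> * renorm x"
proof (cases "a = 0")
  case True
  then show ?thesis using renorm_le_norm[of 0] renorm_nonneg[of 0] by simp
next
  case False
  then have "\<bar>a\<bar> * renorm x \<le> \<bar>a\<bar> * (\<bar>inverse a\<bar> * renorm (a *\<^sub>R x))"
    using renorm_scaleR_le[of "inverse a" "a *\<^sub>R x"] by (intro mult_left_mono) auto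
  also have "\<dots> = renorm (a *\<^sub>R x)"
    using False by (simp flip: mult.assoc abs_mult)
  finally show ?thesis using renorm_scaleR_le[of a x] by simp
qed

lemma renorm_triangle: "renorm (x + y) \<le> renorm x + renorm y"
proof (rule field_le_epsilon)
  fix e :: real assume "0 < e"
  then have e: "0 < e / 2" by simp
  obtain z where z: "norm (x - T z) + q z < renorm x + e / 2" by (rule renorm_approx[OF e])
  obtain w where w: "norm (y - T w) + q w < renorm y + e / 2" by (rule renorm_approx[OF e])
  have "renorm (x + y) \<le> norm ((x - T z) + (y - T w)) + q (z + w)"
    using renorm_le[of "x + y" "z + w"] by (simp add: T_simps algebra_simps)
  also have "\<dots> \<le> (norm (x - T z) + norm (y - T w)) + (q z + q w)"
    by (intro add_mono norm_triangle_ineq q_triangle)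
  finally show "renorm (x + y) \<le> renorm x + renorm y + e" using z w by simp
qed

lemma equivalent_norm_renorm: "equivalent_norm renorm"
  unfolding equivalent_norm_def
proof (intro conjI exI allI)
  show "is_norm renorm"
    unfolding is_norm_def
  proof (intro conjI allI)
    fix x
    show "renorm x = 0 \<longleftrightarrow> x = 0"
      using norm_le_renorm[of x] renorm_le_norm[of x] renorm_nonneg[of x] by auto
  qed (rule renorm_nonneg renorm_scaleR renorm_triangle)+
  show "0 < 1 / max 1 C" "0 < (1::real)" by auto
  fix x
  show "1 / max 1 C * norm x \<le> renorm x"
    using norm_le_renorm[of x] by (simp add: divide_le_eq mult.commute)
  show "renorm x \<le> 1 * norm x" using renorm_le_norm by simp
qed

text \<open>Split \<open>x\<close> almost optimally into \<open>x - T z\<close> and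
  \<open>T z\<close>; \<open>norm f\<close> controls the first part, Cauchy-Schwarz the
  second.\<close>

lemma apply_le_pnorm: "\<bar>blinfun_apply f x\<bar> \<le> pnorm f * renorm x"
proof (rule field_le_epsilon)
  fix e :: real assume "0 < e"
  have p: "0 \<le> pnorm f" by (simp add: pnorm_def le_max_iff_disj)
  \<comment> \<open>The added 1 covers the case \<open>pnorm f = 0\<close>.\<close>
  then have "0 < e / (pnorm f + 1)" using \<open>0 < e\<close> by simp
  then obtain z where z: "norm (x - T z) + q z < renorm x + e / (pnorm f + 1)"
    by (rule renorm_approx)
  have "\<bar>blinfun_apply f x\<bar> \<le> \<bar>blinfun_apply f (x - T z)\<bar> + \<bar>blinfun_apply f (T z)\<bar>"
    by (simp add: blinfun.diff_right)
  also have "\<dots> \<le> norm f * norm (x - T z) + q f * q z"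
    using norm_blinfun[of f "x - T z"] form_le[of f z] by simp
  also have "\<dots> \<le> pnorm f * norm (x - T z) + pnorm f * q z"
    by (intro add_mono mult_right_mono) (auto simp: pnorm_def)
  also have "\<dots> = pnorm f * (norm (x - T z) + q z)" by (simp add: algebra_simps)
  also have "\<dots> \<le> pnorm f * (renorm x + e / (pnorm f + 1))"
    using z p by (intro mult_left_mono) auto
  also have "\<dots> \<le> pnorm f * renorm x + e"
    using p \<open>0 < e\<close> by (simp add: field_simps)
  finally show "\<bar>blinfun_apply f x\<bar> \<le> pnorm f * renorm x + e" .
qed

lemma abs_apply_le_pnorm:
  assumes "x \<in> unit_cball_of renorm" shows "\<bar>blinfun_apply f x\<bar> \<le> pnorm f"
proof -
  have "pnorm f * renorm x \<le> pnorm f * 1"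
    using assms by (intro mult_left_mono) (auto simp: unit_cball_of_def pnorm_def le_max_iff_disj)
  then show ?thesis using apply_le_pnorm[of f x] by simp
qed

text \<open>For the lower bound, the new ball contains the old one, which gives
  \<open>norm f\<close>, and it contains \<open>T f /\<^sub>R q f\<close>, where \<open>f\<close>
  takes the value \<open>q f\<close>.\<close>

lemma dual_norm_renorm: "dual_norm renorm = pnorm"
proof
  fix f :: "'a \<Rightarrow>\<^sub>L real"
  have bdd: "bdd_above ((\<lambda>x. \<bar>blinfun_apply f x\<bar>) ` unit_cball_of renorm)"
    by (rule bdd_aboveI2[where M = "pnorm f"]) (rule abs_apply_le_pnorm)
  have z: "0 \<in> unit_cball_of renorm" "0 \<in> unit_cball_of (norm :: 'a \<Rightarrow> real)"
    using renorm_le_norm[of 0] by (auto simp: unit_cball_of_def)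
  have up: "\<bar>blinfun_apply f x\<bar> \<le> dual_norm renorm f" if "x \<in> unit_cball_of renorm" for x
    unfolding dual_norm_def using cSUP_upper[OF that bdd] .
  have "norm f \<le> dual_norm renorm f"
    unfolding dual_norm_norm[symmetric] dual_norm_def[of norm]
  proof (rule cSUP_least)
    fix x :: 'a assume "x \<in> unit_cball_of norm"
    then show "\<bar>blinfun_apply f x\<bar> \<le> dual_norm renorm f"
      using renorm_le_norm[of x] by (intro up) (auto simp: unit_cball_of_def)
  qed (use z in blast)
  moreover have "q f \<le> dual_norm renorm f"
  proof (cases "q f = 0")
    case True
    then show ?thesis using up[OF z(1)] by simp
  next
    case False
    then have "0 < q f" using q_nonneg[of f] by linarith
    then have "T f /\<^sub>R q f \<in> unit_cball_of renorm"
      using renorm_T_le[of f] by (simp add: unit_cball_of_def renorm_scaleR field_simps)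
    from up[OF this] show ?thesis
      using \<open>0 < q f\<close> by (simp add: blinfun.scaleR_right power2_eq_square field_simps flip: q_sq)
  qed
  moreover have "dual_norm renorm f \<le> pnorm f"
    unfolding dual_norm_def using z abs_apply_le_pnorm by (intro cSUP_least) blast+
  ultimately show "dual_norm renorm f = pnorm f"
    by (simp add: pnorm_def)
qed

text \<open>Symmetry of the ball removes the absolute value from the supremum.\<close>

lemma pnorm_approx:
  assumes "b < pnorm f"
  obtains x where "x \<in> unit_cball_of renorm" "b < blinfun_apply f x"
proof -
  have "0 \<in> unit_cball_of renorm"
    using renorm_le_norm[of 0] by (simp add: unit_cball_of_def)
  moreover have "bdd_above ((\<lambda>x. \<bar>blinfun_apply f x\<bar>) ` unit_cball_of renorm)"
    by (rule bdd_aboveI2[where M = "pnorm f"]) (rule abs_apply_le_pnorm)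
  ultimately obtain x where x: "x \<in> unit_cball_of renorm" "b < \<bar>blinfun_apply f x\<bar>"
    using assms less_cSUP_iff[of "unit_cball_of renorm" "\<lambda>x. \<bar>blinfun_apply f x\<bar>" b]
    unfolding dual_norm_renorm[symmetric] dual_norm_def by blast
  have "- x \<in> unit_cball_of renorm"
    using x(1) renorm_scaleR[of "-1" x] by (simp add: unit_cball_of_def)
  then show thesis
    using x that[of x] that[of "- x"] by (auto simp: blinfun.minus_right abs_if split: if_splits)
qed

section \<open>The ball-covering property\<close>

text \<open>Such a step changes \<open>norm\<close> by at most \<open>norm f / k\<close> and
  \<open>q\<close> by at most \<open>q f / k\<close>, so the strict gap survives for large
  \<open>k\<close>.\<close>

lemma cone_perturb:
  assumes "norm z < q z"
  shows "\<forall>\<^sub>F k in sequentially. norm (z - (1 / real k) *\<^sub>R f) < q (z - (1 / real k) *\<^sub>R f)"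
proof -
  have "(\<lambda>k. (1 / real k) * (norm f + q f)) \<longlonglongrightarrow> 0 * (norm f + q f)"
    by (intro tendsto_intros lim_1_over_n)
  then have "\<forall>\<^sub>F k in sequentially. (1 / real k) * (norm f + q f) < q z - norm z"
    using assms by (intro order_tendstoD(2)[where y = 0]) auto
  then show ?thesis
  proof eventually_elim
    case (elim k)
    have "norm (z - (1 / real k) *\<^sub>R f) \<le> norm z + (1 / real k) * norm f"
      using norm_triangle_ineq4[of z "(1 / real k) *\<^sub>R f"] by simp
    moreover have "q z - (1 / real k) * q f \<le> q (z - (1 / real k) *\<^sub>R f)"
      using q_diff_ge[of z "(1 / real k) *\<^sub>R f"] by (simp add: q_scaleR)
    ultimately show ?case using elim by (simp add: algebra_simps)
  qed
qed

text \<open>On the open cone where \<open>norm < q\<close>, the norm \<open>pnorm\<close> is the Hilbertian \<open>q\<close>, whose derivative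
  at \<open>z\<close> is a multiple of evaluation at \<open>T z\<close>.\<close>

lemma pnorm_decreases:
  assumes z: "norm z < q z" and zf: "0 < blinfun_apply z (T f)"
  shows "\<forall>\<^sub>F k in sequentially. pnorm (z - (1 / real k) *\<^sub>R f) < pnorm z"
proof -
  have "(\<lambda>k. (1 / real k) * (q f)\<^sup>2) \<longlonglongrightarrow> 0 * (q f)\<^sup>2"
    by (intro tendsto_intros lim_1_over_n)
  then have "\<forall>\<^sub>F k in sequentially. (1 / real k) * (q f)\<^sup>2 < 2 * blinfun_apply z (T f)"
    using zf by (intro order_tendstoD(2)[where y = 0]) auto
  then show ?thesis
    using cone_perturb[OF z, of f] eventually_gt_at_top[of 0]
  proof eventually_elim
    case (elim k)
    define t where "t = 1 / real k"
    have t: "0 < t" "t * (q f)\<^sup>2 < 2 * blinfun_apply z (T f)"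
      using elim by (auto simp: t_def)
    \<comment> \<open>The square of \<open>q\<close> changes by
      \<open>t * (t * (q f)\<^sup>2 - 2 * z (T f))\<close>, negative for small \<open>t\<close>.
      Both points lie in the cone, where \<open>pnorm\<close> is \<open>q\<close>.\<close>
    have "t * (t * (q f)\<^sup>2) < t * (2 * blinfun_apply z (T f))"
      using t by (intro mult_strict_left_mono)
    then have "(q (z - t *\<^sub>R f))\<^sup>2 < (q z)\<^sup>2"
      unfolding q_sq_diff by (simp add: power2_eq_square[of t] mult.assoc mult.left_commute)
    then have "q (z - t *\<^sub>R f) < q z"
      by (rule power2_less_imp_less) simp
    then show ?case
      using elim(2) z by (simp add: pnorm_def t_def)
  qed
qed

text \<open>The dual need not be separable, so the selection is made through the images
  \<open>T z\<close> in the separable space itself.\<close>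

lemma countable_total_subset_of_cone:
  assumes sep: "separable_space (euclidean :: 'a topology)"
    and f0: "norm f0 < q f0"
  obtains D where "countable D" "\<And>z. z \<in> D \<Longrightarrow> norm z < q z"
    "\<And>f :: 'a \<Rightarrow>\<^sub>L real. f \<noteq> 0 \<Longrightarrow> \<exists>z\<in>D. blinfun_apply f (T z) \<noteq> 0"
proof -
  obtain Q :: "'a set" where Q: "countable Q" "closure Q = UNIV"
    using sep by (auto simp: separable_space_def)
  define P where "P = (\<lambda>(y, n::nat) z. norm z < q z \<and> dist y (T z) < 1 / Suc n)"
  \<comment> \<open>For each dense point \<open>y\<close> and each tolerance, one cone element whose
    image is that close to \<open>y\<close>, if there is any.\<close>
  define E where "E = (\<lambda>yn. SOME z. P yn z) ` {yn \<in> Q \<times> UNIV. \<exists>z. P yn z}"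
  show thesis
  proof (rule that[of E])
    show "countable E"
      unfolding E_def
      by (rule countable_image, rule countable_subset[of _ "Q \<times> UNIV"]) (use Q(1) in auto)
    have P: "P yn (SOME z. P yn z)" if "\<exists>z. P yn z" for yn
      using that by (rule someI_ex)
    show "norm z < q z" if "z \<in> E" for z
      using that P by (fastforce simp: E_def P_def)
    fix f :: "'a \<Rightarrow>\<^sub>L real" assume f: "f \<noteq> 0"
    obtain z where z: "norm z < q z" "blinfun_apply f (T z) \<noteq> 0"
    proof (cases "blinfun_apply f (T f0) = 0")
      case True
      obtain k where k: "0 < k" "norm (f0 - (1 / real k) *\<^sub>R f) < q (f0 - (1 / real k) *\<^sub>R f)"
        using eventually_happens[OF eventually_conj[OF eventually_gt_at_top[of 0] cone_perturb[OF f0, of f]]]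
        by auto
      \<comment> \<open>The value is \<open>- f (T f) / k\<close>, nonzero by positivity.\<close>
      moreover have "blinfun_apply f (T (f0 - (1 / real k) *\<^sub>R f)) \<noteq> 0"
        using True k(1) pos[OF f] by (simp add: T_simps blinfun.bilinear_simps)
      ultimately show thesis using that by blast
    qed (use f0 that in blast)
    have "open {x. blinfun_apply f x \<noteq> 0}"
      by (intro open_Collect_neq continuous_intros)
    then obtain e where e: "0 < e" "\<And>x. dist x (T z) < e \<Longrightarrow> blinfun_apply f x \<noteq> 0"
      using z(2) by (auto simp: subset_iff dist_commute elim!: openE[of _ "T z"])
    obtain n where n: "1 / real (Suc n) < e / 2"
      using e(1) nat_approx_posE[of "e/2"] by auto
    obtain y where y: "y \<in> Q" "dist y (T z) < 1 / real (Suc n)"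
      using Q(2) closure_approachable[of "T z" Q] by (auto elim!: allE[of _ "1 / real (Suc n)"])
    have "\<exists>z. P (y, n) z" using z(1) y(2) by (auto simp: P_def)
    with P y(1) obtain z' where z': "P (y, n) z'" "z' \<in> E"
      unfolding E_def by blast
    have "dist (T z') (T z) < e"
      using z'(1) y(2) n dist_triangle3[of "T z'" "T z" y] by (auto simp: P_def)
    with e(2) z'(2) show "\<exists>z\<in>E. blinfun_apply f (T z) \<noteq> 0" by blast
  qed
qed

text \<open>For \<open>z\<close> in the cone, the balls with centre \<open>k z\<close> and radius
  \<open>k * pnorm z\<close> eventually contain every \<open>f\<close> with
  \<open>z (T f) > 0\<close>. Their radii equal the norms of their centres, as 0-admissibility
  allows.\<close>

lemma has_BCP_pnorm:
  assumes sep: "separable_space (euclidean :: 'a topology)"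
    and f0: "norm f0 < q f0"
  shows "has_BCP pnorm 0"
proof -
  obtain D where D: "countable D" "\<And>z. z \<in> D \<Longrightarrow> norm z < q z"
    "\<And>f :: 'a \<Rightarrow>\<^sub>L real. f \<noteq> 0 \<Longrightarrow> \<exists>z\<in>D. blinfun_apply f (T z) \<noteq> 0"
    using countable_total_subset_of_cone[OF assms] by blast
  \<comment> \<open>Totality gives only a nonzero \<open>z (T f)\<close>; adding negatives makes it
    positive.\<close>
  define E where "E = D \<union> uminus ` D"
  define B where "B = (\<lambda>(z, k). (real k *\<^sub>R z, real k * pnorm z)) ` (E \<times> {k. 0 < k})"
  have E: "norm z < q z" if "z \<in> E" for z
    using that D(2) by (auto simp: E_def q_minus)
  show ?thesis
    unfolding has_BCP_def
  proof (intro exI conjI)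
    show "countable B"
      unfolding B_def E_def using D(1) by auto
    show "\<forall>(z, r)\<in>B. 0 < r \<and> r + 0 \<le> pnorm z"
    proof -
      have "0 < pnorm z" if "z \<in> E" for z
        using le_less_trans[OF norm_ge_zero E[OF that]] by (simp add: pnorm_def less_max_iff_disj)
      then show ?thesis by (auto simp: B_def pnorm_scaleR)
    qed
    show "sphere_of pnorm \<subseteq> (\<Union>(z, r)\<in>B. ball_of pnorm z r)"
    proof
      fix f assume "f \<in> sphere_of pnorm"
      then have "f \<noteq> 0" by (auto simp: sphere_of_def pnorm_def)
      from D(3)[OF this] obtain z0 where z0: "z0 \<in> D" "blinfun_apply z0 (T f) \<noteq> 0"
        unfolding sym[of f] by blast
      then obtain z where z: "z \<in> E" "0 < blinfun_apply z (T f)"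
        using that[of z0] that[of "- z0"] by (force simp: E_def blinfun.minus_left)
      obtain k where k: "0 < k" "pnorm (z - (1 / real k) *\<^sub>R f) < pnorm z"
        using eventually_happens[OF eventually_conj[OF eventually_gt_at_top[of 0]
              pnorm_decreases[OF E[OF z(1)] z(2)]]] by auto
      have "pnorm (f - real k *\<^sub>R z) = pnorm (real k *\<^sub>R (z - (1 / real k) *\<^sub>R f))"
        using k(1) pnorm_minus[of "f - real k *\<^sub>R z"] by (simp add: scaleR_diff_right)
      also have "\<dots> < real k * pnorm z"
        using k by (simp add: pnorm_scaleR)
      finally have "f \<in> ball_of pnorm (real k *\<^sub>R z) (real k * pnorm z)"
        by (simp add: ball_of_def)
      then show "f \<in> (\<Union>(z, r)\<in>B. ball_of pnorm z r)"
        using z(1) k(1) unfolding B_def by force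
    qed
  qed
qed

section \<open>The bound on the index and the failure of SCD\<close>

text \<open>Subtracting \<open>x\<close> raises the \<open>norm\<close> part by at least 1 and
  lowers the \<open>q\<close> part by at most \<open>q x\<close>.\<close>

lemma pnorm_diff_ge:
  assumes "norm f + 1 \<le> norm (f - x)" "q x \<le> \<alpha>" "0 \<le> \<alpha>"
  shows "pnorm f - \<alpha> \<le> pnorm (f - x)"
  using assms q_diff_ge[of f x] by (auto simp: pnorm_def max_def)

end

locale rough_dual_form = dual_form T C
  for T :: "('a::real_normed_vector \<Rightarrow>\<^sub>L real) \<Rightarrow> 'a" and C :: real +
  fixes \<alpha> :: real
  assumes \<alpha>: "0 \<le> \<alpha>" "\<alpha> < 1"
    and direction: "countable D \<Longrightarrow>
      \<exists>x. norm x = 1 \<and> q x \<le> \<alpha> \<and> (\<forall>f\<in>D. norm f + 1 \<le> norm (f - x))"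
begin

lemma pnorm_direction:
  assumes "countable D"
  obtains x where "pnorm x = 1" "\<And>f. f \<in> D \<Longrightarrow> pnorm f - \<alpha> \<le> pnorm (f - x)"
proof -
  obtain x where x: "norm x = 1" "q x \<le> \<alpha>" "\<forall>f\<in>D. norm f + 1 \<le> norm (f - x)"
    using direction[OF assms] by blast
  show thesis
  proof (rule that)
    show "pnorm x = 1" using x \<alpha> by (simp add: pnorm_def)
  qed (use x pnorm_diff_ge \<alpha> in blast)
qed

text \<open>A direction \<open>x\<close> for the set of centres lies in no ball: \<open>pnorm (x -
  z) \<ge> pnorm z - \<alpha> \<ge> r + \<beta> - \<alpha> > r\<close>.\<close>

lemma not_has_BCP_pnorm:
  assumes "\<alpha> < \<beta>" shows "\<not> has_BCP pnorm \<beta>"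
proof
  assume "has_BCP pnorm \<beta>"
  then obtain B where B: "countable B" "\<forall>(z, r)\<in>B. 0 < r \<and> r + \<beta> \<le> pnorm z"
    "sphere_of pnorm \<subseteq> (\<Union>(z, r)\<in>B. ball_of pnorm z r)"
    unfolding has_BCP_def by blast
  obtain x where x: "pnorm x = 1" "\<And>f. f \<in> fst ` B \<Longrightarrow> pnorm f - \<alpha> \<le> pnorm (f - x)"
    using pnorm_direction[of "fst ` B"] B(1) by auto
  then obtain z r where zr: "(z, r) \<in> B" "pnorm (x - z) < r"
    using B(3) by (auto simp: sphere_of_def ball_of_def)
  moreover have "pnorm z - \<alpha> \<le> pnorm (x - z)"
    using x(2)[of z] zr(1) pnorm_minus[of "z - x"] by force
  ultimately show False using B(2) assms by auto
qed

text \<open>The hypothesis puts 0 into the set of admissible values, so \<open>bc\<close> is a true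
  supremum, and it is at most \<alpha>.\<close>

lemma bc_pnorm:
  assumes "has_BCP pnorm 0" shows "bc pnorm < 1"
proof -
  have "Sup {\<beta> \<in> {-1..<1}. has_BCP pnorm \<beta>} \<le> \<alpha>"
  proof (rule cSup_least)
    show "{\<beta> \<in> {-1..<1}. has_BCP pnorm \<beta>} \<noteq> {}"
      using assms by (auto intro!: exI[of _ 0])
  qed (use not_has_BCP_pnorm in force)
  then show ?thesis using \<alpha> by (simp add: bc_def Let_def)
qed

text \<open>Each slice \<open>{g > a}\<close> of the ball contains a point at which \<open>k g - x\<close>, for \<open>k\<close> large, is almost
  normed; there \<open>x\<close> is at most about \<open>\<alpha> < pnorm x\<close>.\<close>

lemma not_SCD_set: "\<not> SCD_set (unit_cball_of renorm)"
proof
  assume "SCD_set (unit_cball_of renorm)"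
  then obtain S :: "nat \<Rightarrow> 'a set" where S: "\<And>n. is_slice (unit_cball_of renorm) (S n)"
    and hull: "\<And>b. (\<forall>n. b n \<in> S n) \<Longrightarrow> unit_cball_of renorm \<subseteq> closure (convex hull (range b))"
    unfolding SCD_set_def by blast
  have ne: "S n \<noteq> {}"
    and "\<exists>p :: ('a \<Rightarrow>\<^sub>L real) \<times> real. S n = unit_cball_of renorm \<inter> {x. blinfun_apply (fst p) x > snd p}"
    for n
    using S[of n] by (auto simp: is_slice_def)
  then obtain p :: "nat \<Rightarrow> ('a \<Rightarrow>\<^sub>L real) \<times> real"
    where "\<And>n. S n = unit_cball_of renorm \<inter> {x. blinfun_apply (fst (p n)) x > snd (p n)}"
    by metis
  then obtain g :: "nat \<Rightarrow> 'a \<Rightarrow>\<^sub>L real" and a :: "nat \<Rightarrow> real"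
    where ga: "\<And>n. S n = unit_cball_of renorm \<inter> {x. blinfun_apply (g n) x > a n}"
    by (rule that)
  have gap: "a n < pnorm (g n)" for n
  proof -
    obtain y where "y \<in> unit_cball_of renorm" "a n < blinfun_apply (g n) y"
      using ne[of n] ga[of n] by auto
    with abs_apply_le_pnorm[of y "g n"] show ?thesis by linarith
  qed
  \<comment> \<open>The multiples of all the \<open>g n\<close> form a countable set, so one
    \<open>x\<close> handles every slice.\<close>
  obtain x where x: "pnorm x = 1"
    "\<And>f. f \<in> (\<lambda>(k, n). real k *\<^sub>R g n) ` UNIV \<Longrightarrow> pnorm f - \<alpha> \<le> pnorm (f - x)"
    using pnorm_direction[of "(\<lambda>(k, n). real k *\<^sub>R g n) ` UNIV"] by auto
  \<comment> \<open>Room on both sides: above \<alpha> for choosing almost norming points, below 1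
    for separating the ball at the end.\<close>
  define \<beta> where "\<beta> = (\<alpha> + 1) / 2"
  have \<beta>: "\<alpha> < \<beta>" "\<beta> < 1" using \<alpha> by (auto simp: \<beta>_def)
  have "\<exists>y\<in>S n. blinfun_apply x y \<le> \<beta>" for n
  proof -
    \<comment> \<open>The point \<open>y\<close> below loses at most \<open>\<beta> + 1 < 2\<close>
      from \<open>k * pnorm (g n)\<close>, so this \<open>k\<close> keeps it inside the
      slice.\<close>
    obtain k :: nat where k: "2 < real k * (pnorm (g n) - a n)"
      using reals_Archimedean3[of "pnorm (g n) - a n"] gap[of n] by auto
    then have "0 < k" using gap[of n] by (cases k) auto
    have "real k * pnorm (g n) - \<alpha> \<le> pnorm (real k *\<^sub>R g n - x)"
      using x(2)[OF image_eqI[of _ _ "(k, n)"]] by (simp add: pnorm_scaleR)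
    then have "real k * pnorm (g n) - \<beta> < pnorm (real k *\<^sub>R g n - x)"
      using \<beta>(1) by simp
    then obtain y where y: "y \<in> unit_cball_of renorm"
      "real k * pnorm (g n) - \<beta> < blinfun_apply (real k *\<^sub>R g n - x) y"
      by (rule pnorm_approx)
    then have le: "real k * pnorm (g n) - \<beta> + blinfun_apply x y < real k * blinfun_apply (g n) y"
      by (simp add: blinfun.bilinear_simps)
    have "real k * blinfun_apply (g n) y \<le> real k * pnorm (g n)"
      using abs_apply_le_pnorm[OF y(1), of "g n"] by (intro mult_left_mono) auto
    with le have "blinfun_apply x y \<le> \<beta>" by simp
    moreover have "-1 \<le> blinfun_apply x y"
      using abs_apply_le_pnorm[OF y(1), of x] x(1) by simp
    with le k \<beta> have "real k * a n < real k * blinfun_apply (g n) y"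
      by (simp add: algebra_simps)
    then have "a n < blinfun_apply (g n) y" using \<open>0 < k\<close> by simp
    ultimately show ?thesis using y(1) ga by auto
  qed
  then obtain b where b: "\<And>n. b n \<in> S n" "\<And>n. blinfun_apply x (b n) \<le> \<beta>" by metis
  \<comment> \<open>A closed half-space contains all \<open>b n\<close>, yet the ball leaves it
    because \<open>pnorm x = 1 > \<beta>\<close>.\<close>
  have "closure (convex hull (range b)) \<subseteq> {y. blinfun_apply x y \<le> \<beta>}"
  proof (intro closure_minimal hull_minimal)
    show "convex {y. blinfun_apply x y \<le> \<beta>}"
      using convex_linear_vimage[of "blinfun_apply x" "{..\<beta>}"]
      by (simp add: vimage_def blinfun.bounded_linear_right bounded_linear.linear)
    show "closed {y. blinfun_apply x y \<le> \<beta>}"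
      by (intro closed_Collect_le continuous_intros)
  qed (use b in auto)
  moreover obtain y where "y \<in> unit_cball_of renorm" "\<beta> < blinfun_apply x y"
    using pnorm_approx[of \<beta> x] x(1) \<beta> by auto
  ultimately show False using hull[of b] b(1) by force
qed

end

section \<open>The form given by a summable total sequence\<close>

locale summable_total =
  fixes w :: "nat \<Rightarrow> 'a::banach"
  assumes summable_w: "summable (\<lambda>n. norm (w n))"
    and total: "(\<And>n. blinfun_apply f (w n) = 0) \<Longrightarrow> (f :: 'a \<Rightarrow>\<^sub>L real) = 0"
begin

text \<open>The frame operator of \<open>w\<close>; the resulting \<open>q f\<close> is the l2 norm
  of the sequence of values \<open>f (w n)\<close>.\<close>

definition frame :: "('a \<Rightarrow>\<^sub>L real) \<Rightarrow> 'a" where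
  "frame f = (\<Sum>n. blinfun_apply f (w n) *\<^sub>R w n)"

lemma bounded_w: obtains K where "\<And>n. norm (w n) \<le> K"
  using summable_imp_Bseq[OF summable_w] unfolding Bseq_def real_norm_def abs_norm_cancel by blast

lemma summable_norm_frame: "summable (\<lambda>n. norm (blinfun_apply f (w n) *\<^sub>R w n))"
proof -
  obtain K where K: "\<And>n. norm (w n) \<le> K" using bounded_w by blast
  show ?thesis
  proof (rule summable_comparison_test'[where N = 0])
    show "summable (\<lambda>n. norm f * K * norm (w n))"
      by (intro summable_mult summable_w)
    fix n
    have "\<bar>blinfun_apply f (w n)\<bar> \<le> norm f * norm (w n)"
      using norm_blinfun[of f "w n"] by simp
    also have "\<dots> \<le> norm f * K"
      using K by (intro mult_left_mono) auto
    finally show "norm (norm (blinfun_apply f (w n) *\<^sub>R w n)) \<le> norm f * K * norm (w n)"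
      by (simp add: mult_right_mono)
  qed
qed

lemma frame_sums: "(\<lambda>n. blinfun_apply f (w n) *\<^sub>R w n) sums frame f"
  unfolding frame_def by (rule summable_sums, rule summable_norm_cancel, rule summable_norm_frame)

lemma apply_frame_sums:
  "(\<lambda>n. blinfun_apply f (w n) * blinfun_apply g (w n)) sums blinfun_apply f (frame g)"
  using bounded_linear.sums[OF blinfun.bounded_linear_right frame_sums[of g], of f]
  by (simp add: blinfun.scaleR_right mult.commute)

lemma apply_frame: "(\<lambda>n. (blinfun_apply f (w n))\<^sup>2) sums blinfun_apply f (frame f)"
  using apply_frame_sums[of f f] by (simp add: power2_eq_square)

lemma apply_sq_le_apply_frame: "(blinfun_apply f (w n))\<^sup>2 \<le> blinfun_apply f (frame f)"
  using sum_le_suminf[OF sums_summable[OF apply_frame], of "{n}" f]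
  by (simp add: sums_unique[OF apply_frame, symmetric])

sublocale dual_form frame "\<Sum>n. norm (w n)"
proof
  show "frame (f + g) = frame f + frame g" for f g
    using sums_unique2[OF frame_sums[of "f + g"]] sums_add[OF frame_sums[of f] frame_sums[of g]]
    by (simp add: blinfun.add_left scaleR_add_left)
  show "frame (a *\<^sub>R f) = a *\<^sub>R frame f" for a f
    using sums_unique2[OF frame_sums[of "a *\<^sub>R f"]] sums_scaleR_right[OF frame_sums[of f], of a]
    by (simp add: blinfun.scaleR_left)
  fix f g :: "'a \<Rightarrow>\<^sub>L real"
  show "blinfun_apply f (frame g) = blinfun_apply g (frame f)"
    using sums_unique2[OF apply_frame_sums[of f g]] apply_frame_sums[of g f]
    by (simp add: mult.commute)
  show "0 < blinfun_apply f (frame f)" if "f \<noteq> 0"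
  proof -
    obtain n where "blinfun_apply f (w n) \<noteq> 0" using total \<open>f \<noteq> 0\<close> by blast
    then have "0 < (blinfun_apply f (w n))\<^sup>2" by simp
    then show ?thesis using apply_sq_le_apply_frame[of f n] by linarith
  qed
  \<comment> \<open>Each coefficient of the series is at most \<open>q f\<close>, so summing norms
    gives the constant \<open>\<Sum>n. norm (w n)\<close>.\<close>
  have le: "\<bar>blinfun_apply f (w n)\<bar> \<le> sqrt (blinfun_apply f (frame f))" for n
    using apply_sq_le_apply_frame[of f n] by (intro real_le_rsqrt) simp
  have "norm (frame f) \<le> (\<Sum>n. norm (blinfun_apply f (w n) *\<^sub>R w n))"
    unfolding frame_def by (rule summable_norm[OF summable_norm_frame])
  also have "\<dots> \<le> (\<Sum>n. norm (w n) * sqrt (blinfun_apply f (frame f)))"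
    using le
    by (intro suminf_le summable_norm_frame summable_mult2 summable_w)
      (simp add: mult.commute mult_left_mono)
  also have "\<dots> = (\<Sum>n. norm (w n)) * sqrt (blinfun_apply f (frame f))"
    by (rule suminf_mult2[OF summable_w, symmetric])
  finally show "norm (frame f) \<le> (\<Sum>n. norm (w n)) * sqrt (blinfun_apply f (frame f))" .
qed

end

section \<open>Choice of the sequence and conclusion\<close>

lemma blinfun_nearly_norming:
  fixes f :: "'a::real_normed_vector \<Rightarrow>\<^sub>L real"
  assumes "b < norm f" "0 \<le> b"
  obtains u where "norm u \<le> 1" "b < \<bar>blinfun_apply f u\<bar>"
proof -
  have "(0::'a) \<in> unit_cball_of norm" by (simp add: unit_cball_of_def)
  then have "\<not> dual_norm norm f \<le> b" if "\<And>u. norm u \<le> 1 \<Longrightarrow> \<bar>blinfun_apply f u\<bar> \<le> b"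
    using assms dual_norm_norm[of f] by simp
  moreover have "dual_norm norm f \<le> b" if "\<And>u. norm u \<le> 1 \<Longrightarrow> \<bar>blinfun_apply f u\<bar> \<le> b"
    unfolding dual_norm_def using \<open>0 \<in> _\<close> that
    by (intro cSUP_least) (blast, simp add: unit_cball_of_def)
  ultimately show thesis using that by (meson not_le)
qed

lemma separable_total_sequence:
  assumes "separable_space (euclidean :: 'a::banach topology)"
  obtains x :: "nat \<Rightarrow> 'a::banach" where "\<And>n. norm (x n) \<le> 1"
    "\<And>f :: 'a::banach \<Rightarrow>\<^sub>L real. (\<And>n. blinfun_apply f (x n) = 0) \<Longrightarrow> f = 0"
proof -
  obtain Q :: "'a set" where Q: "countable Q" "closure Q = UNIV"
    using assms by (auto simp: separable_space_def)
  then have "Q \<noteq> {}" by auto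
  \<comment> \<open>The added 1 keeps the scaling factor nonzero even at the zero vector, so no
    dense point is lost.\<close>
  define x where "x n = from_nat_into Q n /\<^sub>R (norm (from_nat_into Q n) + 1)" for n
  show thesis
  proof (rule that)
    show "norm (x n) \<le> 1" for n
    proof -
      have "norm (x n) = norm (from_nat_into Q n) / (norm (from_nat_into Q n) + 1)"
        by (simp add: x_def divide_inverse mult.commute)
      then show ?thesis by (simp add: divide_le_eq_1 add_nonneg_pos)
    qed
    fix f :: "'a \<Rightarrow>\<^sub>L real" assume f: "\<And>n. blinfun_apply f (x n) = 0"
    have "blinfun_apply f y = 0" if y: "y \<in> Q" for y
    proof -
      obtain n where "y = from_nat_into Q n"
        using from_nat_into_surj[OF Q(1) y] by metis
      moreover have "norm y + 1 \<noteq> 0" using norm_ge_zero[of y] by linarith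
      ultimately show ?thesis using f[of n] by (simp add: x_def blinfun.scaleR_right)
    qed
    then have "closure Q \<subseteq> {y. blinfun_apply f y = 0}"
      by (intro closure_minimal closed_Collect_eq continuous_intros) auto
    then show "f = 0" using Q(2) by (intro blinfun_eqI) auto
  qed
qed

theorem proposition3p3:
  assumes "separable_space (euclidean :: 'a::banach topology)"
    and "\<not> has_BCP (norm :: ('a \<Rightarrow>\<^sub>L real) \<Rightarrow> real) (-1)"
  shows "\<exists>N :: 'a \<Rightarrow> real. equivalent_norm N \<and>
           has_BCP (dual_norm N) 0 \<and>
           bc (dual_norm N) < 1 \<and>
           \<not> SCD_set (unit_cball_of N)"
proof -
  obtain f0 :: "'a \<Rightarrow>\<^sub>L real" where f0: "norm f0 = 1"
    using not_BCP_minus_one_direction[OF assms(2), of "{}"] by auto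
  \<comment> \<open>Any bound above \<open>1 / sqrt 2\<close> would do: it makes
    \<open>2 * (f0 u)\<^sup>2\<close> exceed 1.\<close>
  obtain u where u: "norm u \<le> 1" "9/10 < \<bar>blinfun_apply f0 u\<bar>"
    using blinfun_nearly_norming[of "9/10" f0] f0 by auto
  obtain x :: "nat \<Rightarrow> 'a" where x: "\<And>n. norm (x n) \<le> 1"
    "\<And>f :: 'a \<Rightarrow>\<^sub>L real. (\<And>n. blinfun_apply f (x n) = 0) \<Longrightarrow> f = 0"
    using separable_total_sequence[OF assms(1)] by blast
  \<comment> \<open>The weight \<open>sqrt 2\<close> puts \<open>f0\<close> into the cone, while a
    unit functional with value at most 1/2 at \<open>u\<close> gets only 1/2 from this term of the
    squared \<open>q\<close>.\<close>
  define w where "w n = (case n of 0 \<Rightarrow> sqrt 2 *\<^sub>R u | Suc m \<Rightarrow> (1/4) ^ Suc m *\<^sub>R x m)" for n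
  have w_simps: "w 0 = sqrt 2 *\<^sub>R u" "w (Suc m) = (1/4) ^ Suc m *\<^sub>R x m" for m
    by (simp_all add: w_def)
  interpret summable_total w
  proof
    have "summable (\<lambda>n. norm (w (Suc n)))"
    proof (rule summable_comparison_test'[where N = 0])
      show "summable (\<lambda>n. (1/4::real) ^ Suc n)"
        by (subst summable_Suc_iff) (simp add: summable_geometric)
      show "norm (norm (w (Suc n))) \<le> (1/4) ^ Suc n" for n
        using mult_left_le[OF x(1)[of n], of "(1/4) ^ Suc n"] by (simp add: w_simps norm_power)
    qed
    then show "summable (\<lambda>n. norm (w n))" by (subst (asm) summable_Suc_iff)
    show "f = 0" if "\<And>n. blinfun_apply f (w n) = 0" for f :: "'a \<Rightarrow>\<^sub>L real"
      using that[of "Suc _"] by (intro x(2)) (simp add: w_simps blinfun.scaleR_right)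
  qed
  have q_le: "(q f)\<^sup>2 \<le> 2 * (blinfun_apply f u)\<^sup>2 + 1/4" if "norm f = 1" for f
  proof -
    have tail: "(\<lambda>n. (blinfun_apply f (w (Suc n)))\<^sup>2) sums ((q f)\<^sup>2 - 2 * (blinfun_apply f u)\<^sup>2)"
      using apply_frame[of f] unfolding q_sq
      by (subst sums_Suc_iff) (simp add: w_simps blinfun.scaleR_right power_mult_distrib)
    \<comment> \<open>Squaring leaves \<open>(1/16) ^ Suc n\<close>, bounded crudely by
      \<open>(1/4) ^ Suc n * (3/4)\<close>, with sum 1/4.\<close>
    have "(q f)\<^sup>2 - 2 * (blinfun_apply f u)\<^sup>2 \<le> 1/3 * (3/4)"
    proof (rule sums_le[OF _ tail])
      have "(\<lambda>n. (1/4) ^ Suc n) sums (1/3 :: real)"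
        using sums_mult[OF geometric_sums[of "1/4 :: real"], of "1/4"] by simp
      then show "(\<lambda>n. (1/4) ^ Suc n * (3/4)) sums (1/3 * (3/4) :: real)"
        by (rule sums_mult2)
      fix n
      have "\<bar>blinfun_apply f (x n)\<bar> \<le> 1"
        using norm_blinfun[of f "x n"] x(1)[of n] that by simp
      then have "(blinfun_apply f (w (Suc n)))\<^sup>2 \<le> ((1/4) ^ Suc n)\<^sup>2 * 1"
        unfolding w_simps blinfun.scaleR_right real_scaleR_def power_mult_distrib
        by (intro mult_left_mono) (auto simp: abs_square_le_1)
      also have "\<dots> = (1/4) ^ Suc n * (1/4) ^ Suc n" by (simp add: power2_eq_square)
      also have "\<dots> \<le> (1/4) ^ Suc n * (3/4)"
        using power_le_one[of "1/4 :: real" n] by (intro mult_left_mono) auto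
      finally show "(blinfun_apply f (w (Suc n)))\<^sup>2 \<le> (1/4) ^ Suc n * (3/4)" .
    qed
    then show ?thesis by simp
  qed
  interpret rough_dual_form frame "\<Sum>n. norm (w n)" "sqrt (3/4)"
  proof
    show "0 \<le> sqrt (3/4)" "sqrt (3/4) < (1::real)" by auto
    fix D :: "('a \<Rightarrow>\<^sub>L real) set" assume "countable D"
    from not_BCP_minus_one_direction_small[OF assms(2) this u(1)]
    obtain y where y: "norm y = 1" "\<bar>blinfun_apply y u\<bar> \<le> 1/2" "\<forall>f\<in>D. norm f + 1 \<le> norm (f - y)"
      by blast
    have "(blinfun_apply y u)\<^sup>2 \<le> (1/2)\<^sup>2"
      using y(2) by (simp add: abs_le_square_iff[symmetric])
    \<comment> \<open>Here 2 * 1/4 + 1/4 = 3/4 < 1.\<close>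
    then have "(q y)\<^sup>2 \<le> 3/4"
      using q_le[OF y(1)] by (simp add: power2_eq_square)
    then have "q y \<le> sqrt (3/4)" by (rule real_le_rsqrt)
    with y show "\<exists>y. norm y = 1 \<and> q y \<le> sqrt (3/4) \<and> (\<forall>f\<in>D. norm f + 1 \<le> norm (f - y))"
      by blast
  qed
  have "norm f0 < q f0"
  proof (rule power2_less_imp_less)
    \<comment> \<open>2 * 81/100 > 1, so the cone is nonempty.\<close>
    have "(9/10)\<^sup>2 \<le> (blinfun_apply f0 u)\<^sup>2"
      using u(2) by (subst abs_le_square_iff[symmetric]) auto
    also have "2 * (blinfun_apply f0 u)\<^sup>2 \<le> (q f0)\<^sup>2"
      using apply_sq_le_apply_frame[of f0 0]
      by (simp add: q_sq w_simps blinfun.scaleR_right power_mult_distrib)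
    finally show "(norm f0)\<^sup>2 < (q f0)\<^sup>2"
      using f0 by (simp add: power2_eq_square)
  qed simp
  from has_BCP_pnorm[OF assms(1) this] show ?thesis
    using equivalent_norm_renorm bc_pnorm not_SCD_set
    by (intro exI[of _ renorm]) (simp add: dual_norm_renorm)
qed

end
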